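(* Let $\mathcal{A}=\langle Q,\Sigma,\delta\rangle$ be a deterministic finite automaton with $n=|Q|$ states. Let $P$ be a set of compressible pairs in $\mathcal{A}$, let $h(P)$ be the synchronizing height of $P$, and for $2\le m\le n$ let $p(P,m)$ be the maximal length of an $m$-subset Frankl-Pin sequence over $P$. Then, for every $m$ with $2\le m\le n$ and every compressible $m$-element subset $M$ of $Q$, there is a word $w\in\Sigma^*$ compressing $M$ (that is, $|Mw|<|M|$) whose length does not exceed $$\binom{n-m+2}{2}-p(P,m)+h(P).$$
   Context: A (deterministic finite) automaton is a triple $\mathcal{A}=\langle Q,\Sigma,\delta\rangle$ with finite state set $Q$, input alphabet $\Sigma$, and complete transition function $\delta\colon Q\times\Sigma\to Q$. The function $\delta$ is extended to words in the usual way; $qw$ denotes the state reached from $q$ by reading $w\in\Sigma^*$, and $Mw=\{qw: q\in M\}$ for $M\subseteq Q$. A word $w$ compresses $M\subseteq Q$ if $|Mw|<|M|$; $M$ is compressible if some word compresses it. A pair means a 2-element subset of $Q$; thus a pair $\{x,y\}$ is compressible if and only if $xw=yw$ for some word $w$. Synchronizing height: for a set $P$ of compressible pairs, $h(P)$ is the minimal $h\ge 0$ such that for each $\{x,y\}\in P$ there is a word $w$ of length $h$ with $xw=yw$. Frankl-Pin sequence: an $m$-subset Frankl-Pin sequence of length $\ell$ is a sequence $(M_i,R_i)$, $1\le i\le\ell$, where each $M_i$ is an $m$-element subset of $Q$, each $R_i$ is a pair contained in $Q$, and (1) $R_i\subseteq M_i$ for $1\le i\le \ell$; (2) $R_i\not\subseteq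 M_j$ for $1\le j<i\le\ell$. The sequence is over $P$ if all $R_i\in P$. (The empty sequence has length $0$.) *)

theory Defs imports Main begin

record ('q, 'a) automaton =
  states :: "'q set"
  alphabet :: "'a set"
  delta :: "'q \<Rightarrow> 'a \<Rightarrow> 'q"

definition automaton :: "('q, 'a) automaton \<Rightarrow> bool" where
  "automaton A \<longleftrightarrow> finite (states A) \<and>
     (\<forall>q\<in>states A. \<forall>a\<in>alphabet A. delta A q a \<in> states A)"

definition run :: "('q, 'a) automaton \<Rightarrow> 'q \<Rightarrow> 'a list \<Rightarrow> 'q" where
  "run A q w = foldl (delta A) q w"

definition compresses :: "('q, 'a) automaton \<Rightarrow> 'a list \<Rightarrow> 'q set \<Rightarrow> bool" where
  "compresses A w M \<longleftrightarrow> card ((\<lambda>q. run A q w) ` M) < card M"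

definition compressible :: "('q, 'a) automaton \<Rightarrow> 'q set \<Rightarrow> bool" where
  "compressible A M \<longleftrightarrow> (\<exists>w\<in>lists (alphabet A). compresses A w M)"

definition pairs :: "('q, 'a) automaton \<Rightarrow> 'q set set" where
  "pairs A = {R. R \<subseteq> states A \<and> card R = 2}"

text \<open>The minimum exists whenever \<open>P\<close> is a set of compressible pairs of an automaton:
  \<open>P\<close> is then finite, and a word identifying two states can be prolonged to any greater length.\<close>

definition sync_height :: "('q, 'a) automaton \<Rightarrow> 'q set set \<Rightarrow> nat" where
  "sync_height A P = (LEAST h. \<forall>x y. {x, y} \<in> P \<longrightarrow>
     (\<exists>w\<in>lists (alphabet A). length w = h \<and> run A x w = run A y w))"

text \<open>The sequence \<open>(M\<^sub>1, R\<^sub>1), \<dots>, (M\<^sub>l, R\<^sub>l)\<close> is a list, indexed from \<open>0\<close>.\<close>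

definition frankl_pin :: "('q, 'a) automaton \<Rightarrow> nat \<Rightarrow> ('q set \<times> 'q set) list \<Rightarrow> bool" where
  "frankl_pin A m s \<longleftrightarrow>
     (\<forall>(M, R)\<in>set s. M \<subseteq> states A \<and> card M = m \<and> R \<in> pairs A) \<and>
     (\<forall>i<length s. snd (s ! i) \<subseteq> fst (s ! i)) \<and>
     (\<forall>i<length s. \<forall>j<i. \<not> snd (s ! i) \<subseteq> fst (s ! j))"

definition frankl_pin_over ::
    "('q, 'a) automaton \<Rightarrow> 'q set set \<Rightarrow> nat \<Rightarrow> ('q set \<times> 'q set) list \<Rightarrow> bool" where
  "frankl_pin_over A P m s \<longleftrightarrow> frankl_pin A m s \<and> snd ` set s \<subseteq> P"

text \<open>The set of lengths contains \<open>0\<close>. It is bounded when the state set is finite, since the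
  pairs \<open>R\<^sub>i\<close> of a Frankl-Pin sequence are distinct, so the maximum exists.\<close>

definition max_frankl_pin :: "('q, 'a) automaton \<Rightarrow> 'q set set \<Rightarrow> nat \<Rightarrow> nat" where
  "max_frankl_pin A P m = Max {length s | s. frankl_pin_over A P m s}"

end

theory Submission
  imports Defs Complex_Main "HOL-Library.Function_Algebras"
begin

text \<open>
  A shortest word \<open>w\<close> compressing \<open>M\<close> yields a Frankl-Pin sequence whose sets are the images of \<open>M\<close>
  under the proper prefixes of \<open>w\<close>. Its first \<open>length w - h(P)\<close> sets contain no pair from \<open>P\<close>, since
  otherwise \<open>w\<close> could be shortened; so any Frankl-Pin sequence over \<open>P\<close> may be appended to this
  initial part. The total length is at most \<open>(n - m + 2) choose 2\<close> by the skew Bollobas inequality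
  for pairs. The latter is proved by attaching to a \<open>d\<close>-set \<open>B\<close> of reals the polynomial
  \<open>\<Prod>b\<in>B. (b\<^sup>2 - b x + y)\<close> of total degree \<open>d\<close>, which vanishes at the elementary symmetric
  functions \<open>(r + s, r s)\<close> of a pair \<open>{r, s}\<close> iff the pair meets \<open>B\<close>.
\<close>

section \<open>The skew Bollobas inequality for pairs\<close>

definition scale_fun :: "real \<Rightarrow> ('x \<Rightarrow> real) \<Rightarrow> 'x \<Rightarrow> real" where
  "scale_fun c f x = c * f x"

text \<open>Addition and zero of functions are already pointwise. With \<open>scale_fun\<close>,
  span and independence become available for real functions on any domain.\<close>

interpretation fun_space: vector_space scale_fun
  by unfold_locales (auto simp: scale_fun_def fun_eq_iff algebra_simps)

text \<open>All functions before \<open>f k\<close> vanish at \<open>u k\<close>, hence so does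
  their whole span, while \<open>f k\<close> does not. So each function lies outside the span of its
  predecessors, and an independent family is no larger than a spanning set.\<close>

lemma triangular_length_le_card:
  fixes f :: "nat \<Rightarrow> 'x \<Rightarrow> real" and u :: "nat \<Rightarrow> 'x"
  assumes "finite T"
    and span: "\<And>i. i < l \<Longrightarrow> f i \<in> fun_space.span T"
    and diag: "\<And>i. i < l \<Longrightarrow> f i (u i) \<noteq> 0"
    and below: "\<And>i j. i < l \<Longrightarrow> j < i \<Longrightarrow> f j (u i) = 0"
  shows "l \<le> card T"
proof -
  have "fun_space.independent (f ` {..<k}) \<and> card (f ` {..<k}) = k" if "k \<le> l" for k
    using that
  proof (induction k)
    case 0
    show ?case by (simp add: fun_space.independent_empty)
  next
    case (Suc k)
    have "g (u k) = 0" if "g \<in> fun_space.span (f ` {..<k})" for g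
      using that
    proof (induction rule: fun_space.span_induct_alt)
      case base
      show ?case by simp
    next
      case (step c x y)
      then show ?case using below[of k] Suc.prems by (auto simp: scale_fun_def)
    qed
    then have notin: "f k \<notin> fun_space.span (f ` {..<k})"
      using diag[of k] Suc.prems by auto
    then have "f k \<notin> f ` {..<k}"
      using fun_space.span_base[of "f k" "f ` {..<k}"] by blast
    moreover have "fun_space.independent (f ` {..<k})" "card (f ` {..<k}) = k"
      using Suc by simp_all
    ultimately show ?case
      using notin by (simp add: lessThan_Suc fun_space.independent_insert)
  qed
  from this[of l] have "fun_space.independent (f ` {..<l})" "card (f ` {..<l}) = l"
    by simp_all
  moreover have "f ` {..<l} \<subseteq> fun_space.span T" using span by auto
  ultimately show ?thesis
    using fun_space.independent_span_bound[OF \<open>finite T\<close>, of "f ` {..<l}"] by simp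
qed

section \<open>Polynomial functions in two variables of bounded total degree\<close>

definition bivariate_monomials :: "nat \<Rightarrow> (real \<times> real \<Rightarrow> real) set" where
  "bivariate_monomials d = {\<lambda>z. fst z ^ i * snd z ^ j | i j. i + j \<le> d}"

lemma bivariate_monomials_eq_image:
  "bivariate_monomials d = (\<lambda>(i, j) z. fst z ^ i * snd z ^ j) ` (SIGMA i:{..d}. {..d - i})"
proof -
  have "{g i j | i j. i + j \<le> d} = (\<lambda>(i, j). g i j) ` (SIGMA i:{..d}. {..d - i})"
    for g :: "nat \<Rightarrow> nat \<Rightarrow> real \<times> real \<Rightarrow> real"
  proof -
    have "(SIGMA i:{..d}. {..d - i}) = {(i, j) | i j. i + j \<le> d}" by auto
    then show ?thesis by auto
  qed
  then show ?thesis unfolding bivariate_monomials_def .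
qed

lemma finite_bivariate_monomials: "finite (bivariate_monomials d)"
  by (simp add: bivariate_monomials_eq_image)

lemma card_bivariate_monomials_le: "card (bivariate_monomials d) \<le> (d + 2) choose 2"
proof -
  \<comment> \<open>Row \<open>i\<close> of the triangle of exponents has \<open>d - i + 1\<close>
    entries; reversing the order of the rows gives the sum of 1 to \<open>d + 1\<close>.\<close>
  have "(\<Sum>i\<le>d. Suc (d - i)) = (\<Sum>i\<le>d. Suc i)"
    using sum.atLeastAtMost_rev[of Suc 0 d] by (simp add: atMost_atLeast0)
  also have "\<dots> = (d + 2) choose 2"
    by (induction d) (simp_all add: numeral_2_eq_2)
  finally have "(\<Sum>i\<le>d. Suc (d - i)) = (d + 2) choose 2" .
  moreover have "card (bivariate_monomials d) \<le> card (SIGMA i:{..d}. {..d - i})"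
    unfolding bivariate_monomials_eq_image by (rule card_image_le) auto
  ultimately show ?thesis by simp
qed

lemma monomial_in_span:
  "i + j \<le> d \<Longrightarrow> (\<lambda>z. fst z ^ i * snd z ^ j) \<in> fun_space.span (bivariate_monomials d)"
  unfolding bivariate_monomials_def by (intro fun_space.span_base) blast

lemma span_bivariate_monomials_mult_affine:
  assumes "f \<in> fun_space.span (bivariate_monomials d)"
  shows "(\<lambda>z. (a + b * fst z + c * snd z) * f z) \<in> fun_space.span (bivariate_monomials (Suc d))"
  using assms
proof (induction rule: fun_space.span_induct_alt)
  case base
  have "(\<lambda>z. (a + b * fst z + c * snd z) * (0 :: real \<times> real \<Rightarrow> real) z) = 0" by auto
  then show ?case by (simp only: fun_space.span_zero)
next
  case (step r g f)
  let ?S = "fun_space.span (bivariate_monomials (Suc d))"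
  obtain i j where ij: "i + j \<le> d" and g: "g = (\<lambda>z. fst z ^ i * snd z ^ j)"
    using step.hyps unfolding bivariate_monomials_def by blast
  \<comment> \<open>The monomial times 1, \<open>fst z\<close> and \<open>snd z\<close>: three
    monomials of degree at most \<open>d + 1\<close> whose combination is the affine multiple of
    \<open>g\<close>.\<close>
  define g0 g1 g2 where g_defs: "g0 = (\<lambda>z :: real \<times> real. fst z ^ i * snd z ^ j)"
    "g1 = (\<lambda>z :: real \<times> real. fst z ^ Suc i * snd z ^ j)"
    "g2 = (\<lambda>z :: real \<times> real. fst z ^ i * snd z ^ Suc j)"
  define f' where "f' = (\<lambda>z. (a + b * fst z + c * snd z) * f z)"
  have "g0 \<in> ?S" "g1 \<in> ?S" "g2 \<in> ?S"
    unfolding g_defs by (rule monomial_in_span; use ij in simp)+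
  moreover have "f' \<in> ?S"
    unfolding f'_def by (rule step.IH)
  ultimately have
    "scale_fun (r * a) g0 + scale_fun (r * b) g1 + scale_fun (r * c) g2 + f' \<in> ?S"
    by (intro fun_space.span_add fun_space.span_scale)
  moreover have "(\<lambda>z. (a + b * fst z + c * snd z) * (scale_fun r g + f) z) =
      scale_fun (r * a) g0 + scale_fun (r * b) g1 + scale_fun (r * c) g2 + f'"
    by (rule ext) (simp add: g g_defs f'_def scale_fun_def algebra_simps)
  ultimately show ?case by (simp only:)
qed

lemma prod_affine_in_span_bivariate_monomials:
  fixes a b c :: "'b \<Rightarrow> real"
  assumes "finite B"
  shows "(\<lambda>z. \<Prod>q\<in>B. a q + b q * fst z + c q * snd z) \<in> fun_space.span (bivariate_monomials (card B))"
  using assms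
proof (induction rule: finite_induct)
  case empty
  show ?case using monomial_in_span[of 0 0 0] by simp
next
  case (insert q B)
  then show ?case
    using span_bivariate_monomials_mult_affine[OF insert.IH, of "a q" "b q" "c q"] by simp
qed

text \<open>Requiring sets to meet only for \<open>j < i\<close> is exactly what makes the values
  \<open>f j (u i)\<close> triangular.\<close>

theorem skew_bollobas_pairs:
  fixes B R :: "nat \<Rightarrow> 'b set"
  assumes "finite Q"
    and B: "\<And>i. i < l \<Longrightarrow> B i \<subseteq> Q \<and> card (B i) = d"
    and R: "\<And>i. i < l \<Longrightarrow> R i \<subseteq> Q \<and> card (R i) = 2"
    and disjoint: "\<And>i. i < l \<Longrightarrow> B i \<inter> R i = {}"
    and meet: "\<And>i j. i < l \<Longrightarrow> j < i \<Longrightarrow> B j \<inter> R i \<noteq> {}"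
  shows "l \<le> (d + 2) choose 2"
proof -
  \<comment> \<open>Distinct real labels for the elements of \<open>Q\<close> allow polynomials to
    be formed from its subsets.\<close>
  obtain t :: "'b \<Rightarrow> nat" where t: "inj_on t Q"
    using finite_imp_inj_to_nat_seg[OF \<open>finite Q\<close>] by blast
  define s where "s q = real (t q)" for q
  have s_eq: "s p = s q \<longleftrightarrow> p = q" if "p \<in> Q" "q \<in> Q" for p q
    using t that by (auto simp: s_def inj_on_def)
  define f where "f i = (\<lambda>z. \<Prod>q\<in>B i. (s q)\<^sup>2 + (- s q) * fst z + 1 * snd z)" for i
  \<comment> \<open>Sum and product do not depend on an order of the two elements, so a pair becomes
    a single point of the plane.\<close>
  define u where "u i = (\<Sum>q\<in>R i. s q, \<Prod>q\<in>R i. s q)" for i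
  have zero_iff: "f j (u i) = 0 \<longleftrightarrow> B j \<inter> R i \<noteq> {}" if "i < l" "j < l" for i j
  proof -
    obtain p q where pq: "R i = {p, q}" "p \<noteq> q"
      using R[OF \<open>i < l\<close>] by (auto simp: card_2_iff)
    have fin: "finite (B j)" using B[OF \<open>j < l\<close>] \<open>finite Q\<close> finite_subset by blast
    \<comment> \<open>At the symmetric functions of the labels of \<open>p\<close> and
      \<open>q\<close>, each factor splits into linear ones.\<close>
    have "f j (u i) = (\<Prod>b\<in>B j. (s b - s p) * (s b - s q))"
      using pq by (simp add: f_def u_def algebra_simps power2_eq_square)
    also have "\<dots> = 0 \<longleftrightarrow> (\<exists>b\<in>B j. s b = s p \<or> s b = s q)"
      using fin by auto
    also have "\<dots> \<longleftrightarrow> B j \<inter> R i \<noteq> {}"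
      using B[OF \<open>j < l\<close>] R[OF \<open>i < l\<close>] s_eq pq by blast
    finally show ?thesis .
  qed
  have "l \<le> card (bivariate_monomials d)"
  proof (rule triangular_length_le_card[where f = f and u = u, OF finite_bivariate_monomials])
    show "f i \<in> fun_space.span (bivariate_monomials d)" if "i < l" for i
    proof -
      have "finite (B i)"
        using B[OF that] \<open>finite Q\<close> finite_subset by blast
      from prod_affine_in_span_bivariate_monomials[OF this,
          of "\<lambda>q. (s q)\<^sup>2" "\<lambda>q. - s q" "\<lambda>_. 1"]
      show ?thesis
        using B[OF that] by (simp only: f_def)
    qed
    show "f i (u i) \<noteq> 0" if "i < l" for i
      using zero_iff[OF that that] disjoint[OF that] by blast
    show "f j (u i) = 0" if "i < l" "j < i" for i j
      using zero_iff[OF that(1), of j] meet[OF that] less_trans[OF that(2,1)] by blast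
  qed
  then show ?thesis using card_bivariate_monomials_le le_trans by blast
qed

section \<open>Frankl-Pin sequences\<close>

text \<open>Passing to complements turns containment of a pair in a set into disjointness, so the
  skew inequality applies with \<open>d = card (states A) - m\<close>.\<close>

lemma length_frankl_pin_le:
  assumes "finite (states A)" and fp: "frankl_pin A m s"
  shows "length s \<le> (card (states A) - m + 2) choose 2"
proof (rule skew_bollobas_pairs[OF assms(1)])
  have elem: "fst (s ! i) \<subseteq> states A \<and> card (fst (s ! i)) = m \<and> snd (s ! i) \<subseteq> states A
      \<and> card (snd (s ! i)) = 2" if "i < length s" for i
    using fp nth_mem[OF that] by (cases "s ! i") (auto simp: frankl_pin_def pairs_def)
  show "states A - fst (s ! i) \<subseteq> states A \<and> card (states A - fst (s ! i)) = card (states A) - m"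
    if "i < length s" for i
    using elem[OF that] card_Diff_subset[of "fst (s ! i)"] finite_subset[OF _ assms(1)] by simp
  show "snd (s ! i) \<subseteq> states A \<and> card (snd (s ! i)) = 2" if "i < length s" for i
    using elem[OF that] by blast
  show "(states A - fst (s ! i)) \<inter> snd (s ! i) = {}" if "i < length s" for i
    using fp that by (auto simp: frankl_pin_def)
  show "(states A - fst (s ! j)) \<inter> snd (s ! i) \<noteq> {}" if "i < length s" "j < i" for i j
    using fp that elem[OF that(1)] unfolding frankl_pin_def by blast
qed

lemma obtain_max_frankl_pin:
  assumes "finite (states A)"
  obtains s where "frankl_pin_over A P m s" "length s = max_frankl_pin A P m"
proof -
  let ?L = "{length s | s. frankl_pin_over A P m s}"
  have "?L \<subseteq> {..(card (states A) - m + 2) choose 2}"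
    using length_frankl_pin_le[OF assms] by (auto simp: frankl_pin_over_def)
  then have "finite ?L" using finite_subset by blast
  moreover have "frankl_pin_over A P m []"
    by (simp add: frankl_pin_over_def frankl_pin_def)
  then have "?L \<noteq> {}" by blast
  ultimately have "max_frankl_pin A P m \<in> ?L"
    unfolding max_frankl_pin_def by (rule Max_in)
  then show ?thesis using that by auto
qed

lemma frankl_pin_append:
  assumes "frankl_pin A m s" "frankl_pin A m s'"
    and cross: "\<And>x y. x \<in> set s \<Longrightarrow> y \<in> set s' \<Longrightarrow> \<not> snd y \<subseteq> fst x"
  shows "frankl_pin A m (s @ s')"
proof -
  have "\<not> snd ((s @ s') ! i) \<subseteq> fst ((s @ s') ! j)" if "i < length (s @ s')" "j < i" for i j
  proof -
    \<comment> \<open>As \<open>j < i\<close>, the later index \<open>i\<close> cannot lie in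
      \<open>s\<close> while \<open>j\<close> lies in \<open>s'\<close>. Only the middle case needs
      \<open>cross\<close>.\<close>
    consider "i < length s" | "length s \<le> i" "j < length s" | "length s \<le> j" by linarith
    then show ?thesis
    proof cases
      case 1
      then show ?thesis using that assms(1) by (auto simp: frankl_pin_def nth_append)
    next
      case 2
      then show ?thesis using that by (simp add: nth_append cross)
    next
      case 3
      then have "i - length s < length s'" "j - length s < i - length s" using that by auto
      then show ?thesis using 3 that assms(2) by (auto simp: frankl_pin_def nth_append)
    qed
  qed
  moreover have "snd ((s @ s') ! i) \<subseteq> fst ((s @ s') ! i)" if "i < length (s @ s')" for i
    using that assms(1,2) by (auto simp: frankl_pin_def nth_append)
  ultimately show ?thesis
    using assms(1,2) unfolding frankl_pin_def by auto
qed

section \<open>Compressing words\<close>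

lemma run_append: "run A q (u @ v) = run A (run A q u) v"
  by (simp add: run_def)

lemma run_in_states:
  assumes "automaton A" "q \<in> states A" "w \<in> lists (alphabet A)"
  shows "run A q w \<in> states A"
  using assms(2,3)
proof (induction w arbitrary: q)
  case Nil
  then show ?case by (simp add: run_def)
next
  case (Cons a w)
  then show ?case using assms(1) by (auto simp: run_def automaton_def)
qed

lemma compresses_iff_not_inj_on:
  assumes "finite M"
  shows "compresses A w M \<longleftrightarrow> \<not> inj_on (\<lambda>q. run A q w) M"
  using assms card_image_le[OF assms, of "\<lambda>q. run A q w"] inj_on_iff_eq_card[OF assms]
  unfolding compresses_def by (metis le_neq_implies_less less_irrefl)

text \<open>The word \<open>u\<close> carries two states of \<open>M\<close> to \<open>x\<close> and
  \<open>y\<close>, which \<open>v\<close> then merges. Every shortcut for a compressing word arises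
  this way.\<close>

lemma compresses_append:
  assumes "finite M" "x \<in> (\<lambda>q. run A q u) ` M" "y \<in> (\<lambda>q. run A q u) ` M" "x \<noteq> y"
    and "run A x v = run A y v"
  shows "compresses A (u @ v) M"
  using assms unfolding compresses_iff_not_inj_on[OF assms(1)] inj_on_def
  by (auto simp: run_append)

text \<open>The least length is attained because some common length works: merging words for the
  finitely many pairs can be padded to the longest one.\<close>

lemma sync_height_word:
  assumes "automaton A" and P: "P \<subseteq> {R \<in> pairs A. compressible A R}"
    and "{x, y} \<in> P"
  shows "\<exists>w\<in>lists (alphabet A). length w = sync_height A P \<and> run A x w = run A y w"
proof -
  have "finite P"
    by (rule finite_subset[of _ "Pow (states A)"])
      (use P assms(1) in \<open>auto simp: pairs_def automaton_def\<close>)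
  \<comment> \<open>A nonempty word supplies a letter for padding. Quantifying over both elements of
    \<open>R\<close> lets the chosen word depend on the set alone.\<close>
  have ex: "\<exists>w\<in>lists (alphabet A). w \<noteq> [] \<and> (\<forall>x\<in>R. \<forall>y\<in>R. run A x w = run A y w)"
    if R: "R \<in> P" for R
  proof -
    obtain x y where xy: "R = {x, y}" "x \<noteq> y"
      using R P by (auto simp: pairs_def card_2_iff)
    obtain w where w: "w \<in> lists (alphabet A)" "compresses A w R"
      using R P by (auto simp: compressible_def)
    have "run A x w = run A y w"
      using w(2) xy by (auto simp: compresses_iff_not_inj_on)
    moreover from this xy have "w \<noteq> []" by (auto simp: run_def)
    ultimately show ?thesis
      using w(1) unfolding xy(1) by (intro bexI[of _ w]) simp_all
  qed
  then obtain W where W: "\<And>R. R \<in> P \<Longrightarrow> W R \<in> lists (alphabet A)" "\<And>R. R \<in> P \<Longrightarrow> W R \<noteq> []"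
      "\<And>R x y. R \<in> P \<Longrightarrow> x \<in> R \<Longrightarrow> y \<in> R \<Longrightarrow> run A x (W R) = run A y (W R)"
    by metis
  define h where "h = Max ((length \<circ> W) ` P)"
  let ?good = "\<lambda>h. \<forall>x y. {x, y} \<in> P \<longrightarrow>
     (\<exists>w\<in>lists (alphabet A). length w = h \<and> run A x w = run A y w)"
  have "?good h"
  proof (intro allI impI)
    fix x y
    assume xy: "{x, y} \<in> P"
    let ?w = "W {x, y}"
    let ?v = "?w @ replicate (h - length ?w) (hd ?w)"
    have "length ?w \<le> h"
      unfolding h_def using \<open>finite P\<close> xy by (intro Max_ge) auto
    then have "length ?v = h" by simp
    moreover have "hd ?w \<in> alphabet A"
      using W(1,2)[OF xy] hd_in_set by blast
    then have "?v \<in> lists (alphabet A)"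
      using W(1)[OF xy] by auto
    moreover have "run A x ?v = run A y ?v"
      using W(3)[OF xy, of x y] by (simp add: run_append)
    ultimately show "\<exists>w\<in>lists (alphabet A). length w = h \<and> run A x w = run A y w" by blast
  qed
  then have "?good (sync_height A P)"
    unfolding sync_height_def by (rule LeastI)
  then show ?thesis using assms(3) by blast
qed

theorem theorem2:
  fixes A :: "('q, 'a) automaton" and P :: "'q set set" and M :: "'q set" and n m :: nat
  assumes "automaton A"
    and "n = card (states A)"
    and "P \<subseteq> {R \<in> pairs A. compressible A R}"
    and "2 \<le> m" and "m \<le> n"
    and "M \<subseteq> states A" and "card M = m" and "compressible A M"
  shows "\<exists>w\<in>lists (alphabet A). compresses A w M \<and>
    int (length w) \<le> int ((n - m + 2) choose 2) - int (max_frankl_pin A P m) + int (sync_height A P)"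
proof -
  have finQ: "finite (states A)" using assms(1) by (simp add: automaton_def)
  then have finM: "finite M" using assms(6) finite_subset by blast
  obtain w0 where "w0 \<in> lists (alphabet A) \<and> compresses A w0 M"
    using assms(8) unfolding compressible_def by blast
  from ex_has_least_nat[of "\<lambda>v. v \<in> lists (alphabet A) \<and> compresses A v M", OF this, of length]
  obtain w where w: "w \<in> lists (alphabet A)" "compresses A w M"
    and shortest: "\<And>v. v \<in> lists (alphabet A) \<Longrightarrow> compresses A v M \<Longrightarrow> length w \<le> length v"
    by blast
  obtain x y where xy: "x \<in> M" "y \<in> M" "x \<noteq> y" "run A x w = run A y w"
    using w(2) by (auto simp: compresses_iff_not_inj_on[OF finM] inj_on_def)
  define N where "N i = (\<lambda>q. run A q (take i w)) ` M" for i
  define R where "R i = {run A x (take i w), run A y (take i w)}" for i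
  have take_w: "take i w \<in> lists (alphabet A)" and drop_w: "drop i w \<in> lists (alphabet A)" for i
    using w(1) by (auto dest: in_set_takeD in_set_dropD)
  \<comment> \<open>By minimality of \<open>w\<close>, no proper prefix compresses
    \<open>M\<close>.\<close>
  have inj: "inj_on (\<lambda>q. run A q (take i w)) M" if "i < length w" for i
    using shortest[OF take_w, of i] that by (auto simp: compresses_iff_not_inj_on[OF finM])
  have N: "N i \<subseteq> states A" "card (N i) = m" if "i < length w" for i
    using run_in_states[OF assms(1) _ take_w] assms(6) card_image[OF inj[OF that]] assms(7)
    by (auto simp: N_def)
  have R_neq: "run A x (take i w) \<noteq> run A y (take i w)" if "i < length w" for i
    using inj[OF that] xy by (auto simp: inj_on_def)
  have R_sub: "R i \<subseteq> N i" for i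
    using xy by (auto simp: R_def N_def)
  have R_pair: "R i \<in> pairs A" if "i < length w" for i
    using R_neq[OF that] R_sub[of i] N(1)[OF that] by (auto simp: pairs_def R_def)
  \<comment> \<open>Otherwise the letters of \<open>w\<close> between positions \<open>j\<close> and
    \<open>i\<close> could be cut out, since \<open>drop i w\<close> merges the pair
    \<open>R i\<close>.\<close>
  have R_new: "\<not> R i \<subseteq> N j" if "i < length w" "j < i" for i j
  proof
    assume "R i \<subseteq> N j"
    moreover have "run A (run A x (take i w)) (drop i w) = run A (run A y (take i w)) (drop i w)"
      using xy(4) by (simp flip: run_append)
    ultimately have "compresses A (take j w @ drop i w) M"
      by (intro compresses_append[OF finM _ _ R_neq[OF that(1)]]) (simp_all add: R_def N_def)
    moreover have "take j w @ drop i w \<in> lists (alphabet A)"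
      using take_w drop_w by simp
    ultimately show False
      using shortest[of "take j w @ drop i w"] that by simp
  qed
  \<comment> \<open>Truncated subtraction: if the height exceeds \<open>length w\<close>, the
    initial part is empty, and \<open>length w <= k + sync_height A P\<close> still holds.\<close>
  define k where "k = length w - sync_height A P"
  \<comment> \<open>Otherwise the prefix of length \<open>j\<close>, followed by a word of length
    \<open>sync_height A P\<close> merging \<open>S\<close>, would compress \<open>M\<close> and be
    shorter than \<open>w\<close>.\<close>
  have no_P: "\<not> S \<subseteq> N j" if "S \<in> P" "j < k" for S j
  proof
    assume "S \<subseteq> N j"
    obtain a b where ab: "S = {a, b}" "a \<noteq> b"
      using subsetD[OF assms(3) \<open>S \<in> P\<close>] by (auto simp: pairs_def card_2_iff)
    then obtain v where v: "v \<in> lists (alphabet A)" "length v = sync_height A P"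
        "run A a v = run A b v"
      using sync_height_word[OF assms(1,3)] \<open>S \<in> P\<close> by blast
    have "compresses A (take j w @ v) M"
      using \<open>S \<subseteq> N j\<close> by (intro compresses_append[OF finM _ _ ab(2) v(3)]) (simp_all add: ab(1) N_def)
    moreover have "take j w @ v \<in> lists (alphabet A)"
      using take_w v(1) by simp
    ultimately show False
      using shortest[of "take j w @ v"] that(2) v(2) by (simp add: k_def)
  qed
  define s where "s = map (\<lambda>i. (N i, R i)) [0..<k]"
  have "frankl_pin A m s"
    using N R_pair R_sub R_new by (auto simp: frankl_pin_def s_def k_def)
  moreover obtain s' where s': "frankl_pin_over A P m s'" "length s' = max_frankl_pin A P m"
    by (rule obtain_max_frankl_pin[OF finQ])
  \<comment> \<open>The appended pairs all belong to \<open>P\<close>, so none fits into an earlier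
    set \<open>N j\<close> with \<open>j < k\<close>.\<close>
  moreover have "\<not> snd b \<subseteq> fst a" if "a \<in> set s" "b \<in> set s'" for a b
    using that s'(1) no_P by (auto simp: s_def frankl_pin_over_def)
  ultimately have "frankl_pin A m (s @ s')"
    by (intro frankl_pin_append) (auto simp: frankl_pin_over_def)
  then have "k + max_frankl_pin A P m \<le> (n - m + 2) choose 2"
    using length_frankl_pin_le[OF finQ, of m "s @ s'"] s'(2) assms(2) by (simp add: s_def)
  then have "int (length w) \<le> int ((n - m + 2) choose 2) - int (max_frankl_pin A P m)
      + int (sync_height A P)"
    by (simp add: k_def)
  with w show ?thesis by blast
qed

end
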